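(* Let $A\in\mathbb{C}^{n\times n}$ be non-zero Hermitian positive semi-definite and let $E\in\mathbb{C}^{n\times n}$ be Hermitian. If $A+E$ is Hermitian positive semi-definite and $\epsilon=\|E\|_2/\|A\|_2<1$, then $$\frac{1}{1+\epsilon}\left(\operatorname{intdim}(A)-n\epsilon\right)\le\operatorname{intdim}(A+E)\le\frac{1}{1-\epsilon}\left(\operatorname{intdim}(A)+n\epsilon\right).$$ If, in addition, $E$ is also positive semi-definite, then $$\frac{\operatorname{intdim}(A)}{1+\epsilon}\le\operatorname{intdim}(A+E)\le\operatorname{intdim}(A)+n\epsilon.$$
   Context: For a non-zero Hermitian positive semi-definite matrix $A\in\mathbb{C}^{n\times n}$, the intrinsic dimension is $\operatorname{intdim}(A)=\operatorname{trace}(A)/\|A\|_2$, where $\|A\|_2$ is the operator two-norm (largest singular value). For the zero matrix, $\operatorname{intdim}(0)=0$. *)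

theory Defs
  imports "HOL-Analysis.Analysis"
begin

definition conj_transpose :: "complex ^ 'n ^ 'm \<Rightarrow> complex ^ 'm ^ 'n" where
  "conj_transpose A = (\<chi> i j. cnj (A $ j $ i))"

definition hermitian :: "complex ^ 'n ^ 'n \<Rightarrow> bool" where
  "hermitian A \<longleftrightarrow> conj_transpose A = A"

text \<open>The quadratic form of a Hermitian matrix is real-valued, so taking \<open>Re\<close> loses nothing.
  The library's inner product on \<open>complex ^ 'n\<close> is the real one; the sesquilinear form is
  therefore written out.\<close>

definition hermitian_psd :: "complex ^ 'n ^ 'n \<Rightarrow> bool" where
  "hermitian_psd A \<longleftrightarrow>
     hermitian A \<and> (\<forall>x. 0 \<le> Re (\<Sum>i\<in>UNIV. cnj (x $ i) * (A *v x) $ i))"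

text \<open>The norm on \<open>complex ^ 'n\<close> is the Euclidean one, so \<open>onorm\<close> is the supremum of
  \<open>norm (A *v x) / norm x\<close> in the two-norm.\<close>

definition op_norm2 :: "complex ^ 'n ^ 'n \<Rightarrow> real" where
  "op_norm2 A = onorm (\<lambda>x. A *v x)"

text \<open>Only meaningful for Hermitian positive semi-definite matrices, whose trace is real.\<close>

definition intdim :: "complex ^ 'n ^ 'n \<Rightarrow> real" where
  "intdim A = (if A = 0 then 0 else Re (trace A) / op_norm2 A)"

end

theory Submission
  imports Defs
begin

text \<open>Write \<open>a\<close>, \<open>e\<close>, \<open>s\<close> for the operator norms of \<open>A\<close>, \<open>E\<close>, \<open>A + E\<close>. Then \<open>a - e \<le> s \<le> a + e\<close>, and every
  diagonal entry of \<open>E\<close> is bounded by \<open>e\<close>, so the traces of \<open>A\<close> and \<open>A + E\<close> differ by at most \<open>n e\<close>;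
  dividing gives the first pair of bounds. If \<open>E\<close> is positive semi-definite, then its trace is
  non-negative and the operator norm is monotone, so \<open>a \<le> s\<close>.\<close>

lemma matrix_vector_mult_axis_component:
  fixes A :: "'a :: semiring_1 ^ 'n ^ 'm"
  shows "(A *v axis j 1) $ i = A $ i $ j"
  by (simp add: matrix_vector_mult_def axis_def if_distrib cong: if_cong)

text \<open>Passes from the sesquilinear form to the library's real inner product, in which all
  later estimates are carried out.\<close>

lemma Re_quadratic_form_eq_inner:
  fixes A :: "complex ^ 'n ^ 'n"
  shows "Re (\<Sum>i\<in>UNIV. cnj (x $ i) * (A *v x) $ i) = x \<bullet> (A *v x)"
  by (simp add: inner_vec_def inner_complex_def)

lemma hermitian_psd_quadratic_form_nonneg: "hermitian_psd A \<Longrightarrow> 0 \<le> x \<bullet> (A *v x)"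
  unfolding hermitian_psd_def Re_quadratic_form_eq_inner by blast

text \<open>Self-adjointness with respect to the real inner product: expand both sides as double
  sums, swap them, and use that \<open>A $ i $ j\<close> and \<open>A $ j $ i\<close> are
  conjugate.\<close>

lemma hermitian_inner_commute:
  assumes "hermitian A"
  shows "(A *v x) \<bullet> y = x \<bullet> (A *v y)"
proof -
  have A: "A $ i $ j = cnj (A $ j $ i)" for i j
    using assms unfolding hermitian_def conj_transpose_def by (metis vec_lambda_beta)
  have Re_inner: "u \<bullet> v = Re (cnj u * v)" for u v :: complex
    by (simp add: inner_complex_def)
  have "(A *v x) \<bullet> y = Re (\<Sum>i\<in>UNIV. \<Sum>j\<in>UNIV. cnj (A $ i $ j) * cnj (x $ j) * y $ i)"
    by (simp add: inner_vec_def matrix_vector_mult_def Re_inner sum_distrib_right del: complex_cnj_cnj)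
  also have "\<dots> = Re (\<Sum>j\<in>UNIV. \<Sum>i\<in>UNIV. cnj (x $ j) * (A $ j $ i * y $ i))"
    by (subst sum.swap) (simp add: A[symmetric] mult_ac)
  also have "\<dots> = x \<bullet> (A *v y)"
    by (simp add: inner_vec_def matrix_vector_mult_def Re_inner sum_distrib_left)
  finally show ?thesis .
qed

text \<open>The real part of each diagonal entry is the value of the quadratic form at a coordinate
  vector.\<close>

lemma trace_hermitian_psd_nonneg:
  assumes "hermitian_psd A"
  shows "0 \<le> Re (trace A)"
proof -
  have "0 \<le> Re (A $ i $ i)" for i
  proof -
    have "axis i 1 \<bullet> (A *v axis i 1) = Re (A $ i $ i)"
      by (simp add: inner_axis' matrix_vector_mult_axis_component inner_complex_def)
    then show ?thesis
      using hermitian_psd_quadratic_form_nonneg[OF assms, of "axis i 1"] by simp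
  qed
  then show ?thesis
    by (simp add: trace_def sum_nonneg)
qed

lemma norm_matrix_vector_le_op_norm2: "norm (A *v x) \<le> op_norm2 A * norm x"
  unfolding op_norm2_def by (rule onorm[OF matrix_vector_mul_bounded_linear])

lemma op_norm2_nonneg: "0 \<le> op_norm2 A"
  unfolding op_norm2_def by (rule onorm_pos_le[OF matrix_vector_mul_bounded_linear])

lemma op_norm2_pos:
  assumes "A \<noteq> 0"
  shows "0 < op_norm2 A"
proof -
  have "\<not> (\<forall>x. A *v x = 0)"
    using assms by (metis matrix_eq matrix_vector_mult_0)
  then show ?thesis
    unfolding op_norm2_def using onorm_pos_lt[OF matrix_vector_mul_bounded_linear] by blast
qed

lemma op_norm2_zero: "op_norm2 (0 :: complex ^ 'a ^ 'a) = 0"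
proof -
  have "(\<lambda>x. (0 :: complex ^ 'a ^ 'a) *v x) = (\<lambda>x. 0)"
    by simp
  then show ?thesis
    unfolding op_norm2_def by (metis onorm_zero)
qed

lemma op_norm2_add_le: "op_norm2 (A + E) \<le> op_norm2 A + op_norm2 E"
  unfolding op_norm2_def matrix_vector_mult_add_rdistrib
  by (intro onorm_triangle matrix_vector_mul_bounded_linear)

lemma op_norm2_uminus: "op_norm2 (- A) = op_norm2 A"
proof -
  have "(\<lambda>x. - A *v x) = (\<lambda>x. - (A *v x))"
    by (simp add: fun_eq_iff vec_eq_iff matrix_vector_mult_def sum_negf)
  then show ?thesis
    unfolding op_norm2_def by (metis onorm_neg)
qed

text \<open>A diagonal entry is a coordinate of the image of a unit vector, so its modulus is at
  most the operator norm.\<close>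

lemma abs_Re_trace_le: "\<bar>Re (trace (E :: complex ^ 'n ^ 'n))\<bar> \<le> real CARD('n) * op_norm2 E"
proof -
  have "\<bar>Re (E $ i $ i)\<bar> \<le> op_norm2 E" for i
  proof -
    have "\<bar>Re (E $ i $ i)\<bar> \<le> norm ((E *v axis i 1) $ i)"
      by (simp add: matrix_vector_mult_axis_component abs_Re_le_cmod)
    also have "\<dots> \<le> norm (E *v axis i 1)"
      by (rule Finite_Cartesian_Product.norm_nth_le)
    also have "\<dots> \<le> op_norm2 E"
      using norm_matrix_vector_le_op_norm2[of E "axis i 1"] by (simp add: norm_axis_1)
    finally show ?thesis .
  qed
  then have "(\<Sum>i\<in>UNIV. \<bar>Re (E $ i $ i)\<bar>) \<le> (\<Sum>i\<in>(UNIV :: 'n set). op_norm2 E)"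
    by (intro sum_mono) auto
  then show ?thesis
    by (simp add: trace_def order_trans[OF sum_abs])
qed

text \<open>Turns a bound on the form of a positive symmetric map into a bound on its norm, by
  elementary means instead of a spectral decomposition.\<close>

lemma norm_le_of_quadratic_form_le:
  fixes f :: "'a :: real_inner \<Rightarrow> 'a"
  assumes lin: "linear f" and sym: "\<And>x y. f x \<bullet> y = x \<bullet> f y"
    and nonneg: "\<And>x. 0 \<le> x \<bullet> f x" and le: "\<And>x. x \<bullet> f x \<le> s * (norm x)\<^sup>2" and "0 < s"
  shows "norm (f x) \<le> s * norm x"
proof -
  define y where "y = f x"
  \<comment> \<open>Evaluating the form at \<open>s x - f x\<close> plays the role of the Cauchy--Schwarz inequality for it.\<close>
  have "(s *\<^sub>R x - y) \<bullet> f (s *\<^sub>R x - y) = s\<^sup>2 * (x \<bullet> f x) - 2 * s * (norm y)\<^sup>2 + y \<bullet> f y"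
    using sym[of x y] unfolding linear_diff[OF lin] linear_scale[OF lin] y_def[symmetric]
    by (simp add: inner_diff inner_commute algebra_simps power2_eq_square flip: power2_norm_eq_inner)
  then have "2 * s * (norm y)\<^sup>2 \<le> s\<^sup>2 * (x \<bullet> f x) + y \<bullet> f y"
    using nonneg[of "s *\<^sub>R x - y"] by linarith
  \<comment> \<open>The form is bounded at both \<open>x\<close> and \<open>y\<close>; the term from
    \<open>y\<close> then cancels one of the two copies of \<open>s * (norm y)\<^sup>2\<close> on
    the left.\<close>
  also have "\<dots> \<le> s\<^sup>2 * (s * (norm x)\<^sup>2) + s * (norm y)\<^sup>2"
    by (intro add_mono mult_left_mono le) simp
  finally have "s * (norm y)\<^sup>2 \<le> s * (s * norm x)\<^sup>2"
    by (simp add: power2_eq_square algebra_simps)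
  then have "(norm y)\<^sup>2 \<le> (s * norm x)\<^sup>2"
    using \<open>0 < s\<close> by simp
  then show ?thesis
    using \<open>0 < s\<close> unfolding y_def by (simp add: power2_le_iff_abs_le)
qed

text \<open>Adding \<open>E\<close> can only increase the quadratic form, and Cauchy-Schwarz bounds
  the form of \<open>A + E\<close> by its operator norm; the preceding lemma converts this into a
  bound on the norm of \<open>A\<close>.\<close>

lemma op_norm2_mono:
  assumes A: "hermitian_psd A" and E: "hermitian_psd E" and "A + E \<noteq> 0"
  shows "op_norm2 A \<le> op_norm2 (A + E)"
proof -
  define s where "s = op_norm2 (A + E)"
  have "x \<bullet> (A *v x) \<le> s * (norm x)\<^sup>2" for x
  proof -
    have "x \<bullet> (A *v x) \<le> x \<bullet> ((A + E) *v x)"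
      using hermitian_psd_quadratic_form_nonneg[OF E, of x]
      by (simp add: matrix_vector_mult_add_rdistrib inner_right_distrib)
    also have "\<dots> \<le> norm x * norm ((A + E) *v x)"
      by (rule norm_cauchy_schwarz)
    also have "\<dots> \<le> norm x * (s * norm x)"
      unfolding s_def by (intro mult_left_mono norm_matrix_vector_le_op_norm2) simp
    finally show ?thesis
      by (simp add: power2_eq_square mult_ac)
  qed
  moreover have "hermitian A"
    using A unfolding hermitian_psd_def by blast
  moreover have "0 < s"
    unfolding s_def using assms by (intro op_norm2_pos)
  ultimately have "norm (A *v x) \<le> s * norm x" for x
    using norm_le_of_quadratic_form_le[OF matrix_vector_mul_linear] hermitian_inner_commute
      hermitian_psd_quadratic_form_nonneg[OF A] by blast
  then show ?thesis
    unfolding s_def op_norm2_def by (rule onorm_le)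
qed

theorem corollary5p20:
  fixes A E :: "complex ^ 'n ^ 'n" and \<epsilon> :: real
  assumes "A \<noteq> 0" and "hermitian_psd A"
    and "hermitian E"
    and "hermitian_psd (A + E)"
    and "\<epsilon> = op_norm2 E / op_norm2 A" and "\<epsilon> < 1"
  shows "(1 / (1 + \<epsilon>) * (intdim A - real CARD('n) * \<epsilon>) \<le> intdim (A + E) \<and>
          intdim (A + E) \<le> 1 / (1 - \<epsilon>) * (intdim A + real CARD('n) * \<epsilon>)) \<and>
         (hermitian_psd E \<longrightarrow>
          intdim A / (1 + \<epsilon>) \<le> intdim (A + E) \<and>
          intdim (A + E) \<le> intdim A + real CARD('n) * \<epsilon>)"
proof -
  define a e s n where "a = op_norm2 A" and "e = op_norm2 E" and "s = op_norm2 (A + E)"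
    and "n = real CARD('n)"
  define t u where "t = Re (trace A)" and "u = Re (trace E)"
  have a: "0 < a" and e: "0 \<le> e"
    unfolding a_def e_def using assms(1) by (simp_all add: op_norm2_pos op_norm2_nonneg)
  have \<epsilon>: "\<epsilon> = e / a" and "e < a"
    using assms(5,6) a unfolding a_def e_def by simp_all
  have s_le: "s \<le> a + e"
    unfolding a_def e_def s_def by (rule op_norm2_add_le)
  have s_ge: "a - e \<le> s"
    \<comment> \<open>Reverse triangle inequality, from writing \<open>A\<close> as
      \<open>(A + E) + (- E)\<close>.\<close>
    using op_norm2_add_le[of "A + E" "- E"] unfolding a_def e_def s_def by (simp add: op_norm2_uminus)
  then have s: "0 < s"
    using \<open>e < a\<close> by linarith
  \<comment> \<open>Hence \<open>intdim (A + E)\<close> is a genuine quotient and not the default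
    value 0.\<close>
  have "A + E \<noteq> 0"
    using s op_norm2_zero unfolding s_def by (metis less_irrefl)
  have trace_add: "Re (trace (A + E)) = t + u"
    by (simp add: t_def u_def trace_def sum.distrib)
  have dimA: "intdim A = t / a" and dimAE: "intdim (A + E) = (t + u) / s"
    using assms(1) \<open>A + E \<noteq> 0\<close> trace_add by (simp_all add: intdim_def t_def a_def s_def)
  have t: "0 \<le> t" and tu: "0 \<le> t + u"
    using trace_hermitian_psd_nonneg assms(2,4) trace_add unfolding t_def by metis+
  have u: "\<bar>u\<bar> \<le> n * e"
    unfolding u_def n_def e_def by (rule abs_Re_trace_le)
  have "1 / (1 + \<epsilon>) * (intdim A - n * \<epsilon>) = (t - n * e) / (a + e)"
    unfolding dimA \<epsilon> using a e by (simp add: divide_simps)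
  also have "\<dots> \<le> (t + u) / (a + e)"
    using a e u by (intro divide_right_mono) auto
  \<comment> \<open>Shrinking the denominator enlarges the quotient because \<open>t + u\<close>,
    the trace of a positive semi-definite matrix, is non-negative.\<close>
  also have "\<dots> \<le> (t + u) / s"
    using tu s s_le by (intro divide_left_mono) auto
  finally have 1: "1 / (1 + \<epsilon>) * (intdim A - n * \<epsilon>) \<le> intdim (A + E)"
    unfolding dimAE .
  have "(t + u) / s \<le> (t + n * e) / (a - e)"
    using t tu u s_ge \<open>e < a\<close> by (intro frac_le) auto
  also have "\<dots> = 1 / (1 - \<epsilon>) * (intdim A + n * \<epsilon>)"
    unfolding dimA \<epsilon> using a \<open>e < a\<close> by (simp add: divide_simps)
  finally have 2: "intdim (A + E) \<le> 1 / (1 - \<epsilon>) * (intdim A + n * \<epsilon>)"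
    unfolding dimAE .
  have 3: "intdim A / (1 + \<epsilon>) \<le> intdim (A + E) \<and> intdim (A + E) \<le> intdim A + n * \<epsilon>"
    if E: "hermitian_psd E"
  proof
    have "0 \<le> u"
      unfolding u_def by (rule trace_hermitian_psd_nonneg[OF E])
    have "intdim A / (1 + \<epsilon>) = t / (a + e)"
      unfolding dimA \<epsilon> using a e by (simp add: divide_simps)
    also have "\<dots> \<le> (t + u) / s"
      using t \<open>0 \<le> u\<close> s s_le by (intro frac_le) auto
    finally show "intdim A / (1 + \<epsilon>) \<le> intdim (A + E)"
      unfolding dimAE .
    \<comment> \<open>Monotonicity replaces the lower bound \<open>a - e\<close> on \<open>s\<close>
      by \<open>a\<close>, which removes the factor \<open>1 / (1 - \<epsilon>)\<close>.\<close>
    have "a \<le> s"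
      unfolding a_def s_def by (rule op_norm2_mono[OF assms(2) E \<open>A + E \<noteq> 0\<close>])
    then have "(t + u) / s \<le> (t + n * e) / a"
      using t tu u a by (intro frac_le) auto
    also have "\<dots> = intdim A + n * \<epsilon>"
      unfolding dimA \<epsilon> by (simp add: add_divide_distrib)
    finally show "intdim (A + E) \<le> intdim A + n * \<epsilon>"
      unfolding dimAE .
  qed
  show ?thesis
    using 1 2 3 unfolding n_def by blast
qed

end
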